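(* For each of the following 2-dimensional commutative complex pre-Lie algebras $A_i$ with basis $\{e_1,e_2\}$ (products of basis elements not listed are zero), a linear map $N:A_i\to A_i$ is a Nijenhuis operator if and only if it is one of the maps listed for $A_i$. All $n_{ij}$ are arbitrary complex numbers subject only to the stated restrictions. (1) $A_1$: $e_1\cdot e_1=e_1,\ e_2\cdot e_2=e_2$. Operators: - $N^1_{A_1}(e_1)=n_{11}e_1,\ N^1_{A_1}(e_2)=n_{21}e_1+(n_{11}+n_{21})e_2$, $n_{21}\neq 0$; - $N^2_{A_1}(e_1)=n_{11}e_1,\ N^2_{A_1}(e_2)=n_{22}e_2$; - $N^3_{A_1}(e_1)=n_{11}e_1+n_{12}e_2,\ N^3_{A_1}(e_2)=(n_{11}-n_{12})e_2$, $n_{12}\neq 0$. (2) $A_2$: $e_1\cdot e_1=e_1,\ e_1\cdot e_2=e_2\cdot e_1=e_2$. Operators: - $N^1_{A_2}(e_1)=n_{11}e_1,\ N^1_{A_2}(e_2)=n_{22}e_2$; - $N^2_{A_2}(e_1)=n_{11}e_1+n_{12}e_2,\ N^2_{A_2}(e_2)=n_{11}e_2$, $n_{12}\neq 0$. (3) $A_3$: $e_1\cdot e_1=e_1$. Operators: - $N^1_{A_3}(e_1)=n_{11}e_1,\ N^1_{A_3}(e_2)=n_{22}e_2$; - $N^2_{A_3}(e_1)=n_{11}e_1+n_{12}e_2,\ N^2_{A_3}(e_2)=n_{11}e_2$, $n_{12}\neq 0$. (4) $A_4$: $e_i\cdot e_j=0$ for $i,j=1,2$. Operators: - $N^1_{A_4}(e_1)=n_{11}e_1+n_{12}e_2,\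 N^1_{A_4}(e_2)=n_{21}e_1+n_{22}e_2$ (every linear map). (5) $A_5$: $e_1\cdot e_1=e_2$. Operators: - $N^1_{A_5}(e_1)=n_{11}e_1+n_{12}e_2,\ N^1_{A_5}(e_2)=n_{11}e_2$.
   Context: A (complex) pre-Lie algebra is a complex vector space $A$ with a bilinear product $\cdot$ satisfying $(x\cdot y)\cdot z-x\cdot(y\cdot z)=(y\cdot x)\cdot z-y\cdot(x\cdot z)$ for all $x,y,z\in A$. A Nijenhuis operator on $(A,\cdot)$ is a linear map $N:A\to A$ such that $N(x)\cdot N(y)=N\big(N(x)\cdot y+x\cdot N(y)-N(x\cdot y)\big)$ for all $x,y\in A$. *)

theory Defs
  imports Complex_Main
begin

locale complex_algebra = vector_space scale
  for scale :: "complex \<Rightarrow> 'a::ab_group_add \<Rightarrow> 'a" +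
  fixes mul :: "'a \<Rightarrow> 'a \<Rightarrow> 'a"
  assumes linear_mul_right: "\<And>x. Vector_Spaces.linear scale scale (\<lambda>y. mul x y)"
    and linear_mul_left: "\<And>y. Vector_Spaces.linear scale scale (\<lambda>x. mul x y)"

locale pre_lie_algebra = complex_algebra +
  assumes left_symmetric:
    "\<And>x y z. mul (mul x y) z - mul x (mul y z) = mul (mul y x) z - mul y (mul x z)"

locale commutative_pre_lie_algebra = pre_lie_algebra +
  assumes mul_commute: "\<And>x y. mul x y = mul y x"

locale nijenhuis_operator = pre_lie_algebra +
  fixes N :: "'a \<Rightarrow> 'a"
  assumes linear_N: "Vector_Spaces.linear scale scale N"
    and nijenhuis: "\<And>x y. mul (N x) (N y) = N (mul (N x) y + mul x (N y) - N (mul x y))"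

text \<open>
  The condition \<open>e1 \<noteq> e2\<close> is not redundant: \<open>{e1, e2}\<close> is a set, so without it the
  dimension could be 1. The algebras below are given by bilinearity and the products of the
  basis elements only; that they are commutative and pre-Lie is not assumed.
\<close>

locale two_dim_algebra = complex_algebra +
  fixes e1 e2 :: 'a
  assumes distinct_basis: "e1 \<noteq> e2"
    and independent_basis: "independent {e1, e2}"
    and span_basis: "span {e1, e2} = UNIV"

locale algebra_A1 = two_dim_algebra +
  assumes "mul e1 e1 = e1" "mul e1 e2 = 0" "mul e2 e1 = 0" "mul e2 e2 = e2"

locale algebra_A2 = two_dim_algebra +
  assumes "mul e1 e1 = e1" "mul e1 e2 = e2" "mul e2 e1 = e2" "mul e2 e2 = 0"

locale algebra_A3 = two_dim_algebra +
  assumes "mul e1 e1 = e1" "mul e1 e2 = 0" "mul e2 e1 = 0" "mul e2 e2 = 0"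

locale algebra_A4 = two_dim_algebra +
  assumes "mul e1 e1 = 0" "mul e1 e2 = 0" "mul e2 e1 = 0" "mul e2 e2 = 0"

locale algebra_A5 = two_dim_algebra +
  assumes "mul e1 e1 = e2" "mul e1 e2 = 0" "mul e2 e1 = 0" "mul e2 e2 = 0"

end

(* In coordinates x = (a, b) with respect to e1, e2 each of the five products is polynomial, so
   the pre-Lie axiom (here: commutativity and associativity) and the Nijenhuis identity become
   polynomial identities. Evaluating the Nijenhuis identity at pairs of basis vectors already
   yields equations on the matrix of N whose solutions are exactly the listed operators. *)
theory Submission
  imports Defs
begin

section \<open>Bilinear products and associativity\<close>

context complex_algebra
begin

lemma mul_add_right: "mul x (y + z) = mul x y + mul x z"
  and mul_scale_right: "mul x (scale a y) = scale a (mul x y)"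
  using linear_mul_right[of x] by (simp_all add: Vector_Spaces.linear_iff)

lemma mul_add_left: "mul (x + y) z = mul x z + mul y z"
  and mul_scale_left: "mul (scale a x) z = scale a (mul x z)"
  using linear_mul_left[of z] by (simp_all add: Vector_Spaces.linear_iff)

text \<open>Under associativity both sides of the left-symmetry axiom are associators equal to zero.
  This is the form in which the axiom is checked for each of the five algebras.\<close>

lemma commutative_pre_lieI:
  assumes comm: "\<And>x y. mul x y = mul y x"
    and assoc: "\<And>x y z. mul (mul x y) z = mul x (mul y z)"
  shows "commutative_pre_lie_algebra scale mul"
proof unfold_locales
  fix x y z
  show "mul (mul x y) z - mul x (mul y z) = mul (mul y x) z - mul y (mul x z)"
    by (simp add: assoc)
qed (rule comm)

end

section \<open>Coordinates with respect to the basis e1, e2\<close>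

context two_dim_algebra
begin

definition comb :: "complex \<Rightarrow> complex \<Rightarrow> 'a"
  where "comb a b = scale a e1 + scale b e2"

lemma comb_exists: "\<exists>a b. x = comb a b"
proof -
  have "x \<in> span {e1, e2}"
    by (simp add: span_basis)
  then show ?thesis
    unfolding comb_def by (auto simp: span_insert span_singleton algebra_simps)
qed

lemma comb_cases: obtains a b where "x = comb a b"
  using comb_exists by blast

lemma comb_eq_0_iff: "comb a b = 0 \<longleftrightarrow> a = 0 \<and> b = 0"
proof
  assume *: "comb a b = 0"
  \<comment> \<open>Linear independence speaks of sums over a finite set, so the two coefficients
    are packed into one function. It can take the values a and b separately because of
    \<open>distinct_basis\<close>.\<close>
  define u where "u x = (if x = e1 then a else b)" for x
  have "(\<Sum>v\<in>{e1, e2}. scale (u v) v) = 0"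
    using * distinct_basis by (simp add: comb_def u_def)
  then have "u e1 = 0" "u e2 = 0"
    using independentD[OF independent_basis, of "{e1, e2}" u] by auto
  then show "a = 0 \<and> b = 0"
    using distinct_basis by (auto simp: u_def)
qed (simp add: comb_def)

text \<open>Normalisation rules: together with \<open>product\<close> and \<open>linear_comb\<close>
  they collapse each side of an identity to a single \<open>comb\<close>, and
  \<open>comb_eq_iff\<close> then leaves two equations between complex numbers.\<close>

lemma comb_add: "comb a b + comb c d = comb (a + c) (b + d)"
  and comb_diff: "comb a b - comb c d = comb (a - c) (b - d)"
  and scale_comb: "scale k (comb a b) = comb (k * a) (k * b)"
  by (simp_all add: comb_def algebra_simps)

lemma zero_eq_comb: "0 = comb 0 0"
  by (simp add: comb_def)

lemma scale_basis_eq_comb: "scale k e1 = comb k 0" "scale k e2 = comb 0 k"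
  by (simp_all add: comb_def)

lemma comb_eq_iff: "comb a b = comb c d \<longleftrightarrow> a = c \<and> b = d"
  using comb_eq_0_iff[of "a - c" "b - d"] by (simp flip: comb_diff)

lemma mul_comb:
  "mul (comb a b) (comb c d) =
    scale (a * c) (mul e1 e1) + scale (a * d) (mul e1 e2) +
    scale (b * c) (mul e2 e1) + scale (b * d) (mul e2 e2)"
  by (simp add: comb_def mul_add_left mul_add_right mul_scale_left mul_scale_right algebra_simps)

text \<open>The pairs (p, q) and (r, s) are the rows of the matrix of N acting on row vectors; these
  four letters keep this meaning for every algebra below.\<close>

lemma linear_comb:
  assumes "Vector_Spaces.linear scale scale N" "N e1 = comb p q" "N e2 = comb r s"
  shows "N (comb a b) = comb (a * p + b * r) (a * q + b * s)"
proof -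
  have "N (comb a b) = scale a (N e1) + scale b (N e2)"
    using assms(1) by (simp add: comb_def Vector_Spaces.linear_iff)
  then show ?thesis
    by (simp add: assms scale_comb comb_add)
qed

text \<open>The predicate \<open>nijenhuis_operator\<close> also bundles the pre-Lie axioms and the
  linearity of N. With these granted, only the identity itself is left to decide.\<close>

lemma nijenhuis_operator_iff:
  assumes "commutative_pre_lie_algebra scale mul" "Vector_Spaces.linear scale scale N"
  shows "nijenhuis_operator scale mul N \<longleftrightarrow>
    (\<forall>x y. mul (N x) (N y) = N (mul (N x) y + mul x (N y) - N (mul x y)))"
  using assms unfolding nijenhuis_operator_def nijenhuis_operator_axioms_def
    commutative_pre_lie_algebra_def by blast

text \<open>Quantifying over coordinates lets basis vectors be chosen by inserting 0 and 1, and
  turns the converse direction into a polynomial identity in a, b, c, d.\<close>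

lemma nijenhuis_comb_iff:
  assumes "commutative_pre_lie_algebra scale mul" "Vector_Spaces.linear scale scale N"
  shows "nijenhuis_operator scale mul N \<longleftrightarrow>
    (\<forall>a b c d. mul (N (comb a b)) (N (comb c d)) =
      N (mul (N (comb a b)) (comb c d) + mul (comb a b) (N (comb c d)) - N (mul (comb a b) (comb c d))))"
  unfolding nijenhuis_operator_iff[OF assms] by (metis comb_exists)

end

section \<open>A_1: the product algebra C \<times> C\<close>

context algebra_A1
begin

lemma product: "mul (comb a b) (comb c d) = comb (a * c) (b * d)"
  using algebra_A1_axioms unfolding algebra_A1_def algebra_A1_axioms_def mul_comb
  by (simp add: comb_def algebra_simps)

lemma commutative_pre_lie: "commutative_pre_lie_algebra scale mul"
proof (rule commutative_pre_lieI)
  fix x y z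
  obtain a b c d f g where "x = comb a b" "y = comb c d" "z = comb f g"
    using comb_cases by metis
  then show "mul x y = mul y x" "mul (mul x y) z = mul x (mul y z)"
    by (simp_all add: product comb_eq_iff algebra_simps)
qed

lemma nijenhuis_iff:
  assumes N: "Vector_Spaces.linear scale scale N"
  shows "nijenhuis_operator scale mul N \<longleftrightarrow>
    (\<exists>n11 n21. n21 \<noteq> 0 \<and> N e1 = scale n11 e1 \<and> N e2 = scale n21 e1 + scale (n11 + n21) e2) \<or>
    (\<exists>n11 n22. N e1 = scale n11 e1 \<and> N e2 = scale n22 e2) \<or>
    (\<exists>n11 n12. n12 \<noteq> 0 \<and> N e1 = scale n11 e1 + scale n12 e2 \<and> N e2 = scale (n11 - n12) e2)"
    (is "?L \<longleftrightarrow> ?R")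
proof -
  obtain p q r s where e: "N e1 = comb p q" "N e2 = comb r s"
    using comb_cases by metis
  note iff = nijenhuis_comb_iff[OF commutative_pre_lie N]
  note simps = product linear_comb[OF N e] comb_add comb_diff comb_eq_iff
  \<comment> \<open>The three alternatives are mutually exclusive: N is diagonal, has only r nonzero
    off the diagonal, or has only q nonzero there.\<close>
  have "?L \<longleftrightarrow>
    (q = 0 \<and> r = 0) \<or> (q = 0 \<and> r \<noteq> 0 \<and> s = p + r) \<or> (r = 0 \<and> q \<noteq> 0 \<and> s = p - q)"
    (is "_ \<longleftrightarrow> ?C")
  proof
    assume ?L
    note * = this[unfolded iff, rule_format]
    \<comment> \<open>The pair (e1, e1) gives q r = 0 and q (p - q - s) = 0; the pair (e2, e2) gives
      q r = 0 and r (s - p - r) = 0.\<close>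
    show ?C
      using *[of 1 0 1 0] *[of 0 1 0 1]
      by (simp add: simps) algebra
  next
    assume ?C
    \<comment> \<open>With these relations the identity holds for arbitrary coordinates, so the
      mixed pair (e1, e2) imposes nothing further.\<close>
    then show ?L
      unfolding iff by (auto simp: simps algebra_simps)
  qed
  also have "\<dots> \<longleftrightarrow> ?R"
    by (auto simp: e scale_basis_eq_comb comb_add comb_eq_iff)
  finally show ?thesis .
qed

end

section \<open>A_2: the dual numbers, with unit e1\<close>

context algebra_A2
begin

lemma product: "mul (comb a b) (comb c d) = comb (a * c) (a * d + b * c)"
  using algebra_A2_axioms unfolding algebra_A2_def algebra_A2_axioms_def mul_comb
  by (simp add: comb_def algebra_simps)

lemma commutative_pre_lie: "commutative_pre_lie_algebra scale mul"
proof (rule commutative_pre_lieI)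
  fix x y z
  obtain a b c d f g where "x = comb a b" "y = comb c d" "z = comb f g"
    using comb_cases by metis
  then show "mul x y = mul y x" "mul (mul x y) z = mul x (mul y z)"
    by (simp_all add: product comb_eq_iff algebra_simps)
qed

lemma nijenhuis_iff:
  assumes N: "Vector_Spaces.linear scale scale N"
  shows "nijenhuis_operator scale mul N \<longleftrightarrow>
    (\<exists>n11 n22. N e1 = scale n11 e1 \<and> N e2 = scale n22 e2) \<or>
    (\<exists>n11 n12. n12 \<noteq> 0 \<and> N e1 = scale n11 e1 + scale n12 e2 \<and> N e2 = scale n11 e2)"
    (is "?L \<longleftrightarrow> ?R")
proof -
  obtain p q r s where e: "N e1 = comb p q" "N e2 = comb r s"
    using comb_cases by metis
  note iff = nijenhuis_comb_iff[OF commutative_pre_lie N]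
  note simps = product linear_comb[OF N e] comb_add comb_diff comb_eq_iff
  have "?L \<longleftrightarrow> r = 0 \<and> (q = 0 \<or> s = p)"
    (is "_ \<longleftrightarrow> ?C")
  proof
    assume ?L
    note * = this[unfolded iff, rule_format]
    \<comment> \<open>As e1 is the unit, the pair (e1, e1) says that the square of N(e1) is
      N(N(e1)), that is q r = 0 and q (p - s) = 0. The pair (e2, e2) gives r^2 = 2 r^2, hence r =
      0.\<close>
    show ?C
      using *[of 1 0 1 0] *[of 0 1 0 1]
      by (simp add: simps) algebra
  next
    assume ?C
    then show ?L
      unfolding iff by (auto simp: simps algebra_simps)
  qed
  \<comment> \<open>If q = 0 and s = p both hold, N is already in the diagonal family, so demanding
    n12 \<noteq> 0 in the second family loses no operator.\<close>
  also have "\<dots> \<longleftrightarrow> ?R"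
    by (auto simp: e scale_basis_eq_comb comb_add comb_eq_iff)
  finally show ?thesis .
qed

end

section \<open>A_3: the direct sum of C and a null line\<close>

context algebra_A3
begin

lemma product: "mul (comb a b) (comb c d) = comb (a * c) 0"
  using algebra_A3_axioms unfolding algebra_A3_def algebra_A3_axioms_def mul_comb
  by (simp add: comb_def algebra_simps)

lemma commutative_pre_lie: "commutative_pre_lie_algebra scale mul"
proof (rule commutative_pre_lieI)
  fix x y z
  obtain a b c d f g where "x = comb a b" "y = comb c d" "z = comb f g"
    using comb_cases by metis
  then show "mul x y = mul y x" "mul (mul x y) z = mul x (mul y z)"
    by (simp_all add: product comb_eq_iff algebra_simps)
qed

lemma nijenhuis_iff:
  assumes N: "Vector_Spaces.linear scale scale N"
  shows "nijenhuis_operator scale mul N \<longleftrightarrow>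
    (\<exists>n11 n22. N e1 = scale n11 e1 \<and> N e2 = scale n22 e2) \<or>
    (\<exists>n11 n12. n12 \<noteq> 0 \<and> N e1 = scale n11 e1 + scale n12 e2 \<and> N e2 = scale n11 e2)"
    (is "?L \<longleftrightarrow> ?R")
proof -
  obtain p q r s where e: "N e1 = comb p q" "N e2 = comb r s"
    using comb_cases by metis
  \<comment> \<open>Here two equal \<open>comb\<close> terms can meet in a difference, which
    simplification cancels to a literal 0 that \<open>linear_comb\<close> does not match.\<close>
  have N0: "N 0 = comb 0 0"
    using linear_comb[OF N e, of 0 0] by (simp add: zero_eq_comb)
  note iff = nijenhuis_comb_iff[OF commutative_pre_lie N]
  note simps = product linear_comb[OF N e] comb_add comb_diff comb_eq_iff N0
  have "?L \<longleftrightarrow> r = 0 \<and> (q = 0 \<or> s = p)"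
    (is "_ \<longleftrightarrow> ?C")
  proof
    assume ?L
    note * = this[unfolded iff, rule_format]
    \<comment> \<open>The pair (e1, e1) gives q r = 0 and q (p - s) = 0; the pair (e2, e2) gives r^2
      = 0.\<close>
    show ?C
      using *[of 1 0 1 0] *[of 0 1 0 1]
      by (simp add: simps) algebra
  next
    assume ?C
    then show ?L
      unfolding iff by (auto simp: simps algebra_simps)
  qed
  also have "\<dots> \<longleftrightarrow> ?R"
    by (auto simp: e scale_basis_eq_comb comb_add comb_eq_iff)
  finally show ?thesis .
qed

end

section \<open>A_4: the zero product\<close>

context algebra_A4
begin

lemma product: "mul (comb a b) (comb c d) = comb 0 0"
  using algebra_A4_axioms unfolding algebra_A4_def algebra_A4_axioms_def mul_comb
  by (simp add: comb_def algebra_simps)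

lemma commutative_pre_lie: "commutative_pre_lie_algebra scale mul"
proof (rule commutative_pre_lieI)
  fix x y z
  obtain a b c d f g where "x = comb a b" "y = comb c d" "z = comb f g"
    using comb_cases by metis
  then show "mul x y = mul y x" "mul (mul x y) z = mul x (mul y z)"
    by (simp_all add: product comb_eq_iff algebra_simps)
qed

lemma nijenhuis_iff:
  assumes N: "Vector_Spaces.linear scale scale N"
  shows "nijenhuis_operator scale mul N \<longleftrightarrow>
    (\<exists>n11 n12 n21 n22. N e1 = scale n11 e1 + scale n12 e2 \<and> N e2 = scale n21 e1 + scale n22 e2)"
    (is "?L \<longleftrightarrow> ?R")
proof -
  obtain p q r s where e: "N e1 = comb p q" "N e2 = comb r s"
    using comb_cases by metis
  have N0: "N 0 = comb 0 0"
    using linear_comb[OF N e, of 0 0] by (simp add: zero_eq_comb)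
  note iff = nijenhuis_comb_iff[OF commutative_pre_lie N]
  note simps = product linear_comb[OF N e] comb_add comb_diff comb_eq_iff N0
  \<comment> \<open>Every product vanishes, so both sides of the identity are 0 for any linear
    N.\<close>
  have "?L \<longleftrightarrow> True"
    by (simp add: iff simps)
  also have "\<dots> \<longleftrightarrow> ?R"
    by (auto simp: e scale_basis_eq_comb comb_add comb_eq_iff)
  finally show ?thesis .
qed

end

section \<open>A_5: the nilpotent algebra t C[t] / (t^3), with e1 = t and e2 = t^2\<close>

context algebra_A5
begin

lemma product: "mul (comb a b) (comb c d) = comb 0 (a * c)"
  using algebra_A5_axioms unfolding algebra_A5_def algebra_A5_axioms_def mul_comb
  by (simp add: comb_def algebra_simps)

lemma commutative_pre_lie: "commutative_pre_lie_algebra scale mul"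
proof (rule commutative_pre_lieI)
  fix x y z
  obtain a b c d f g where "x = comb a b" "y = comb c d" "z = comb f g"
    using comb_cases by metis
  then show "mul x y = mul y x" "mul (mul x y) z = mul x (mul y z)"
    by (simp_all add: product comb_eq_iff algebra_simps)
qed

lemma nijenhuis_iff:
  assumes N: "Vector_Spaces.linear scale scale N"
  shows "nijenhuis_operator scale mul N \<longleftrightarrow>
    (\<exists>n11 n12. N e1 = scale n11 e1 + scale n12 e2 \<and> N e2 = scale n11 e2)"
    (is "?L \<longleftrightarrow> ?R")
proof -
  obtain p q r s where e: "N e1 = comb p q" "N e2 = comb r s"
    using comb_cases by metis
  have N0: "N 0 = comb 0 0"
    using linear_comb[OF N e, of 0 0] by (simp add: zero_eq_comb)
  note iff = nijenhuis_comb_iff[OF commutative_pre_lie N]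
  note simps = product linear_comb[OF N e] comb_add comb_diff comb_eq_iff N0
  have "?L \<longleftrightarrow> r = 0 \<and> s = p"
    (is "_ \<longleftrightarrow> ?C")
  proof
    assume ?L
    note * = this[unfolded iff, rule_format]
    \<comment> \<open>The pair (e2, e2) gives r^2 = 0. With r = 0 the pair (e1, e1) becomes p^2 = s
      (2 p - s), that is (p - s)^2 = 0. The entry q occurs only multiplied by r and so stays
      free.\<close>
    show ?C
      using *[of 1 0 1 0] *[of 0 1 0 1]
      by (simp add: simps) algebra
  next
    assume ?C
    then show ?L
      unfolding iff by (auto simp: simps algebra_simps)
  qed
  also have "\<dots> \<longleftrightarrow> ?R"
    by (auto simp: e scale_basis_eq_comb comb_add comb_eq_iff)
  finally show ?thesis .
qed

end

theorem theorem3p1: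
  fixes scale :: "complex \<Rightarrow> 'a::ab_group_add \<Rightarrow> 'a"
    and mul :: "'a \<Rightarrow> 'a \<Rightarrow> 'a"
    and e1 e2 :: 'a
  shows "
    (algebra_A1 scale mul e1 e2 \<longrightarrow>
      commutative_pre_lie_algebra scale mul \<and>
      (\<forall>N. Vector_Spaces.linear scale scale N \<longrightarrow>
        (nijenhuis_operator scale mul N \<longleftrightarrow>
           (\<exists>n11 n21. n21 \<noteq> 0 \<and> N e1 = scale n11 e1 \<and> N e2 = scale n21 e1 + scale (n11 + n21) e2) \<or>
           (\<exists>n11 n22. N e1 = scale n11 e1 \<and> N e2 = scale n22 e2) \<or>
           (\<exists>n11 n12. n12 \<noteq> 0 \<and> N e1 = scale n11 e1 + scale n12 e2 \<and> N e2 = scale (n11 - n12) e2)))) \<and>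
    (algebra_A2 scale mul e1 e2 \<longrightarrow>
      commutative_pre_lie_algebra scale mul \<and>
      (\<forall>N. Vector_Spaces.linear scale scale N \<longrightarrow>
        (nijenhuis_operator scale mul N \<longleftrightarrow>
           (\<exists>n11 n22. N e1 = scale n11 e1 \<and> N e2 = scale n22 e2) \<or>
           (\<exists>n11 n12. n12 \<noteq> 0 \<and> N e1 = scale n11 e1 + scale n12 e2 \<and> N e2 = scale n11 e2)))) \<and>
    (algebra_A3 scale mul e1 e2 \<longrightarrow>
      commutative_pre_lie_algebra scale mul \<and>
      (\<forall>N. Vector_Spaces.linear scale scale N \<longrightarrow>
        (nijenhuis_operator scale mul N \<longleftrightarrow>
           (\<exists>n11 n22. N e1 = scale n11 e1 \<and> N e2 = scale n22 e2) \<or>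
           (\<exists>n11 n12. n12 \<noteq> 0 \<and> N e1 = scale n11 e1 + scale n12 e2 \<and> N e2 = scale n11 e2)))) \<and>
    (algebra_A4 scale mul e1 e2 \<longrightarrow>
      commutative_pre_lie_algebra scale mul \<and>
      (\<forall>N. Vector_Spaces.linear scale scale N \<longrightarrow>
        (nijenhuis_operator scale mul N \<longleftrightarrow>
           (\<exists>n11 n12 n21 n22. N e1 = scale n11 e1 + scale n12 e2 \<and> N e2 = scale n21 e1 + scale n22 e2)))) \<and>
    (algebra_A5 scale mul e1 e2 \<longrightarrow>
      commutative_pre_lie_algebra scale mul \<and>
      (\<forall>N. Vector_Spaces.linear scale scale N \<longrightarrow>
        (nijenhuis_operator scale mul N \<longleftrightarrow>
           (\<exists>n11 n12. N e1 = scale n11 e1 + scale n12 e2 \<and> N e2 = scale n11 e2))))"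
  by (intro conjI impI allI)
    (simp_all only: algebra_A1.commutative_pre_lie algebra_A1.nijenhuis_iff
      algebra_A2.commutative_pre_lie algebra_A2.nijenhuis_iff
      algebra_A3.commutative_pre_lie algebra_A3.nijenhuis_iff
      algebra_A4.commutative_pre_lie algebra_A4.nijenhuis_iff
      algebra_A5.commutative_pre_lie algebra_A5.nijenhuis_iff)

end
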